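(* Let $m\geq 2$ be an integer and let $t$ be a positive integer such that $p:=\gcd(m,t)$ is a prime and $t+p=3m$. Define a sequence $(c(n))_{n\geq m-1}$ by $c(m-1)=t$ and, for $n\geq m$, $$c(n)=c(n-1)+\gcd(n,\,c(n-1)).$$ Then for every $n\geq m$, the difference $c(n)-c(n-1)$ is either $1$ or a prime. *)

theory Defs
  imports "HOL-Computational_Algebra.Primes"
begin

end

theory Submission
  imports Defs
begin

text \<open>
  The first step gives \<open>c m = 3 * m\<close>. Suppose \<open>c N = 3 * N\<close> with \<open>N \<ge> 2\<close>. As long as the
  differences after \<open>N\<close> are 1, the next one is \<open>gcd (N + k) (3 * N + k - 1) =
  gcd (N + k) (2 * N - 1)\<close>, which divides \<open>2 * k + 1\<close>. If \<open>k\<close> is the first index where it is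
  not 1, any prime factor of it equals \<open>2 * k + 1\<close>, for a smaller one \<open>2 * j + 1\<close>
  would already divide \<open>N + j\<close>. So the difference is the prime \<open>2 * k + 1\<close>, and the sequence
  arrives at \<open>c (N + k) = 3 * (N + k)\<close>, where the argument repeats.
\<close>

lemma gcd_eq_of_first_not_coprime:
  fixes N k :: nat
  assumes "N \<ge> 1"
    and first: "\<And>j. 1 \<le> j \<Longrightarrow> j < k \<Longrightarrow> coprime (N + j) (2 * N - 1)"
    and not1: "gcd (N + k) (2 * N - 1) \<noteq> 1"
  shows "gcd (N + k) (2 * N - 1) = 2 * k + 1 \<and> prime (2 * k + 1)"
proof -
  define g where "g = gcd (N + k) (2 * N - 1)"
  have "2 * (N + k) = (2 * k + 1) + (2 * N - 1)" using assms(1) by simp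
  moreover have "g dvd 2 * (N + k)" and g2: "g dvd 2 * N - 1" unfolding g_def by (blast intro: dvd_mult gcd_dvd1 gcd_dvd2)+
  ultimately have gk: "g dvd 2 * k + 1" by (metis dvd_add_left_iff)
  obtain q where q: "prime q" "q dvd g"
    using not1 prime_factor_nat unfolding g_def by blast
  have qN: "q dvd 2 * N - 1" and qk: "q dvd 2 * k + 1" using q g2 gk dvd_trans by blast+
  have "odd q" using dvd_trans[of 2 q "2 * k + 1"] qk by auto
  then obtain j where j: "q = 2 * j + 1" by (auto elim: oddE)
  have "j \<ge> 1" using q(1) j by (cases j) auto
  \<comment> \<open>Adding \<open>q = 2 * j + 1\<close> turns \<open>2 * N - 1\<close> into
    \<open>2 * (N + j)\<close>; the factor 2 cancels as \<open>q\<close> is odd.\<close>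
  have "q dvd (2 * N - 1) + q" using qN by simp
  also have "(2 * N - 1) + q = 2 * (N + j)" using assms(1) j by simp
  finally have "q dvd N + j" using \<open>odd q\<close>
    using coprime_dvd_mult_right_iff[of q 2 "N + j"] by simp
  have "\<not> coprime (N + j) (2 * N - 1)"
    using qN q(1) coprime_common_divisor[of "N + j" "2 * N - 1" q] \<open>q dvd N + j\<close>
    by (auto simp: prime_nat_iff)
  then have "k \<le> j" using first \<open>j \<ge> 1\<close> by force
  moreover have "j \<le> k" using dvd_imp_le[OF qk] j by simp
  ultimately have "q = 2 * k + 1" using j by simp
  then show ?thesis using q gk dvd_antisym unfolding g_def by blast
qed

theorem theorem2:
  fixes m t p :: nat and c :: "nat \<Rightarrow> nat"
  assumes "m \<ge> 2"
    and "t > 0"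
    and "p = gcd m t"
    and "prime p"
    and "t + p = 3 * m"
    and "c (m - 1) = t"
    and "\<And>n. n \<ge> m \<Longrightarrow> c n = c (n - 1) + gcd n (c (n - 1))"
  shows "\<forall>n\<ge>m. c n - c (n - 1) = 1 \<or> prime (c n - c (n - 1))"
proof -
  have cm: "c m = 3 * m" using assms(3,5,6) assms(7)[of m] by simp
  have rec: "c (Suc n) = c n + gcd (Suc n) (c n)" if "n \<ge> m" for n
    using assms(7)[of "Suc n"] that by simp
  \<comment> \<open>Invariant: \<open>N\<close> is the latest index with \<open>c N = 3 * N\<close>,
    and every step from \<open>N\<close> to \<open>n\<close> adds 1. The coprimality clause
    remembers those steps and supplies the minimality of \<open>k\<close>.\<close>
  define run where "run N n \<longleftrightarrow> m \<le> N \<and> N \<le> n \<and> c n = 3 * N + (n - N) \<and>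
    (\<forall>j. 1 \<le> j \<longrightarrow> j \<le> n - N \<longrightarrow> coprime (N + j) (2 * N - 1))" for N n
  have run_step: "(\<exists>N'. run N' (Suc n)) \<and> (c (Suc n) - c n = 1 \<or> prime (c (Suc n) - c n))"
    if "run N n" for N n
  proof -
    define k where "k = Suc n - N"
    have N: "m \<le> N" "N \<le> n" and cn: "c n = 3 * N + (n - N)"
      and cop: "\<And>j. 1 \<le> j \<Longrightarrow> j < k \<Longrightarrow> coprime (N + j) (2 * N - 1)"
      using that by (auto simp: run_def k_def)
    have k: "k \<ge> 1" "Suc n = N + k" using N by (simp_all add: k_def)
    \<comment> \<open>The summand \<open>N + k\<close> is \<open>Suc n\<close> itself, so it drops
      out of the gcd.\<close>
    have "c n = (N + k) + (2 * N - 1)" using cn k N assms(1) by simp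
    then have g: "gcd (Suc n) (c n) = gcd (N + k) (2 * N - 1)"
      using k by (simp only: gcd_add2)
    show ?thesis
    proof (cases "gcd (N + k) (2 * N - 1) = 1")
      case True
      have "coprime (N + j) (2 * N - 1)" if "1 \<le> j" "j \<le> k" for j
        using that cop True by (cases "j = k") (auto simp: coprime_iff_gcd_eq_1)
      then have "run N (Suc n)"
        using N cn g True rec[of n] by (auto simp: run_def k_def)
      then show ?thesis using rec[of n] N g True by auto
    next
      case False
      then have *: "gcd (N + k) (2 * N - 1) = 2 * k + 1" "prime (2 * k + 1)"
        using gcd_eq_of_first_not_coprime[of N k] cop N assms(1) by auto
      have d: "c (Suc n) = c n + (2 * k + 1)" using rec[of n] N g * by simp
      \<comment> \<open>Here \<open>(3 * N + k - 1) + (2 * k + 1) = 3 * (N + k)\<close>, so a new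
        run starts with no coprimality conditions yet.\<close>
      then have "run (Suc n) (Suc n)" using cn N k by (simp add: run_def)
      then show ?thesis using d * by auto
    qed
  qed
  have runs: "\<exists>N. run N n" if "n \<ge> m" for n
    using that
  proof (induction n rule: dec_induct)
    case base
    show ?case using cm by (auto simp: run_def intro!: exI[of _ m])
  next
    case (step n)
    then show ?case using \<open>\<And>N n. run N n \<Longrightarrow> _ N n\<close> by blast
  qed
  show ?thesis
  proof (intro allI impI)
    fix n assume "m \<le> n"
    show "c n - c (n - 1) = 1 \<or> prime (c n - c (n - 1))"
    proof (cases "n = m")
      case True
      \<comment> \<open>Runs start only at \<open>m\<close>; the step into \<open>m\<close> adds
        \<open>gcd m t = p\<close>, prime by assumption.\<close>
      then show ?thesis using assms(3,4,6) assms(7)[of m] by simp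
    next
      case False
      then obtain l where "n = Suc l" "m \<le> l" using \<open>m \<le> n\<close> by (cases n) auto
      then show ?thesis using runs[of l] run_step by auto
    qed
  qed
qed

end
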